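(* Let $(\mathcal{C},T,C,\succeq)$ be a target–context category and let $s\colon P\otimes C\to T\otimes C$ be a simulator with compiler $s_T\colon P\to T$. Let $\varphi\colon \mathcal{C}_{\rm fun}(I,T)\to\mathbb{R}$ be monotone with respect to the lax context-reduction preorder on $\mathcal{C}_{\rm fun}(I,T)$, i.e. $\varphi(f)\ge\varphi(g)$ whenever $f$ lax context-reduces to $g$. If $$\sup \varphi\bigl(\mathrm{Im}_{\rm fun}(s_T)\bigr) < \sup \varphi\bigl(\mathrm{Im}_{\rm fun}(\mathrm{id}_T)\bigr),$$ then $s$ is not a universal simulator. (Note $\mathrm{Im}_{\rm fun}(\mathrm{id}_T)=\mathcal{C}_{\rm fun}(I,T)$.)
   Context: A gs-monoidal category is a symmetric monoidal category $\mathcal{C}$ (tensor $\otimes$, unit $I$, unitors suppressed) in which every object $A$ carries morphisms $\mathrm{copy}_A\colon A\to A\otimes A$ and $\mathrm{del}_A\colon A\to I$ making $A$ a commutative comonoid, with $\mathrm{copy}_{A\otimes X}=(\mathrm{id}_A\otimes\mathrm{swap}_{A,X}\otimes\mathrm{id}_X)\circ(\mathrm{copy}_A\otimes\mathrm{copy}_X)$, $\mathrm{del}_{A\otimes X}=\mathrm{del}_A\otimes\mathrm{del}_X$, $\mathrm{del}_I=\mathrm{id}_I$ (morphisms need not commute with copy/delete). For $f\colon A\to X$: $\mathrm{dom}(f):=(\mathrm{id}_A\otimes(\mathrm{del}_X\circ f))\circ\mathrm{copy}_A$; $f$ is normalized if $f\circ\mathrm{dom}(f)=f$; functional if $\mathrm{copy}_X\circ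 f=(f\otimes f)\circ\mathrm{copy}_A$. For $f,g\colon A\to X$, write $f\sqsupseteq g$ if $f\circ\mathrm{dom}(g)=g$. $\mathcal{C}_{\rm fun}(A,X)$ denotes the functional morphisms $A\to X$. A target–context category $(\mathcal{C},T,C,\succeq)$ is a gs-monoidal category $\mathcal{C}$ all of whose morphisms are normalized, with distinguished objects $T$ and $C$ and a preorder $\succeq$ on every hom-set $\mathcal{C}(A,T\otimes C)$ such that $f\sqsupseteq g\Rightarrow f\succeq g$ and $f\succeq g\Rightarrow f\circ h\succeq g\circ h$ for all $f,g\colon A\to T\otimes C$, $h\colon Z\to A$. A simulator with programs $P$ is a morphism $s\colon P\otimes C\to T\otimes C$ for which there are a functional $s_T\colon P\to T$ (the compiler) and $s_C\colon P\otimes C\to C$ (the context reduction) with $s=(s_T\otimes s_C)\circ(\mathrm{copy}_P\otimes\mathrm{id}_C)$, $(\mathrm{id}_T\otimes\mathrm{del}_C)\circ s=s_T\otimes\mathrm{del}_C$ and $(\mathrm{del}_T\otimes\mathrm{id}_C)\circ s=s_C$. It is universal if there is a functional $r\colon T\to P$ with $s\circ(r\otimes\mathrm{id}_C)\succeq\mathrm{id}_{T\otimes C}$. For $f,g\colon A\to T$, $f$ lax context-reduces to $g$ if there is $f_C\colon A\otimes C\to C$ with $(f\otimes f_C)\circ(\mathrm{copy}_A\otimes\mathrm{id}_C)\succeq g\otimes\mathrm{id}_C$. The functional image of $f\in\mathcal{C}_{\rm fun}(A,T)$ is $\mathrm{Im}_{\rm fun}(f):=\{f\circ a: a\in\mathcal{C}_{\rm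 fun}(I,A)\}$. *)

theory Defs
  imports Complex_Main "HOL-Library.Extended_Real"
begin

section \<open>Symmetric monoidal categories\<close>

text \<open>
  Composition and tensor are total functions on the type of arrows; the axioms below
  constrain them only on composable, respectively genuine, arrows. The monoidal structure is not
  assumed to be strict, so every associator and unitor that is suppressed in the usual notation
  is written out. Throughout, \<open>\<otimes>\<close> is the tensor of objects and \<open>\<boxtimes>\<close> the tensor of arrows.
\<close>

record ('o, 'm) category =
  Obj :: "'o set"
  Arr :: "'m set"
  src :: "'m \<Rightarrow> 'o"
  tgt :: "'m \<Rightarrow> 'o"
  ident :: "'o \<Rightarrow> 'm" ("\<^bold>1\<index>")
  comp :: "'m \<Rightarrow> 'm \<Rightarrow> 'm" (infixr "\<cdot>\<index>" 65)

definition hom :: "('o, 'm, 'x) category_scheme \<Rightarrow> 'o \<Rightarrow> 'o \<Rightarrow> 'm set" where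
  "hom \<C> A B = {f \<in> Arr \<C>. src \<C> f = A \<and> tgt \<C> f = B}"

locale category =
  fixes \<C> :: "('o, 'm, 'x) category_scheme" (structure)
  assumes src_obj: "f \<in> Arr \<C> \<Longrightarrow> src \<C> f \<in> Obj \<C>"
    and tgt_obj: "f \<in> Arr \<C> \<Longrightarrow> tgt \<C> f \<in> Obj \<C>"
    and id_hom: "A \<in> Obj \<C> \<Longrightarrow> \<^bold>1 A \<in> hom \<C> A A"
    and comp_hom: "f \<in> hom \<C> A B \<Longrightarrow> g \<in> hom \<C> B D \<Longrightarrow> g \<cdot> f \<in> hom \<C> A D"
    and comp_id_left: "f \<in> hom \<C> A B \<Longrightarrow> \<^bold>1 B \<cdot> f = f"
    and comp_id_right: "f \<in> hom \<C> A B \<Longrightarrow> f \<cdot> \<^bold>1 A = f"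
    and comp_assoc:
      "f \<in> hom \<C> A B \<Longrightarrow> g \<in> hom \<C> B D \<Longrightarrow> h \<in> hom \<C> D E \<Longrightarrow> (h \<cdot> g) \<cdot> f = h \<cdot> (g \<cdot> f)"

definition inverse_arrows :: "('o, 'm, 'x) category_scheme \<Rightarrow> 'm \<Rightarrow> 'm \<Rightarrow> bool" where
  "inverse_arrows \<C> f g \<longleftrightarrow>
     f \<in> Arr \<C> \<and> g \<in> hom \<C> (tgt \<C> f) (src \<C> f) \<and>
     g \<cdot>\<^bsub>\<C>\<^esub> f = \<^bold>1\<^bsub>\<C>\<^esub> (src \<C> f) \<and> f \<cdot>\<^bsub>\<C>\<^esub> g = \<^bold>1\<^bsub>\<C>\<^esub> (tgt \<C> f)"

definition is_iso :: "('o, 'm, 'x) category_scheme \<Rightarrow> 'm \<Rightarrow> bool" where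
  "is_iso \<C> f \<longleftrightarrow> (\<exists>g. inverse_arrows \<C> f g)"

definition inv_arrow :: "('o, 'm, 'x) category_scheme \<Rightarrow> 'm \<Rightarrow> 'm" where
  "inv_arrow \<C> f = (THE g. inverse_arrows \<C> f g)"

record ('o, 'm) monoidal = "('o, 'm) category" +
  unit :: 'o ("\<^bold>I\<index>")
  tensor :: "'o \<Rightarrow> 'o \<Rightarrow> 'o" (infixr "\<otimes>\<index>" 75)
  tensor_arr :: "'m \<Rightarrow> 'm \<Rightarrow> 'm" (infixr "\<boxtimes>\<index>" 75)
  associator :: "'o \<Rightarrow> 'o \<Rightarrow> 'o \<Rightarrow> 'm" ("\<alpha>\<index>")
  lunitor :: "'o \<Rightarrow> 'm" ("\<ell>\<index>")
  runitor :: "'o \<Rightarrow> 'm" ("\<rho>\<index>")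
  swap_arr :: "'o \<Rightarrow> 'o \<Rightarrow> 'm" ("swap\<index>")

locale symmetric_monoidal_category = category \<C>
  for \<C> :: "('o, 'm, 'x) monoidal_scheme" (structure) +
  assumes unit_obj: "\<^bold>I \<in> Obj \<C>"
    and tensor_obj: "A \<in> Obj \<C> \<Longrightarrow> B \<in> Obj \<C> \<Longrightarrow> A \<otimes> B \<in> Obj \<C>"
    and tensor_hom:
      "f \<in> hom \<C> A B \<Longrightarrow> g \<in> hom \<C> D E \<Longrightarrow> f \<boxtimes> g \<in> hom \<C> (A \<otimes> D) (B \<otimes> E)"
    and tensor_id: "A \<in> Obj \<C> \<Longrightarrow> B \<in> Obj \<C> \<Longrightarrow> \<^bold>1 A \<boxtimes> \<^bold>1 B = \<^bold>1 (A \<otimes> B)"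
    and interchange:
      "f \<in> hom \<C> A B \<Longrightarrow> f' \<in> hom \<C> B D \<Longrightarrow> g \<in> hom \<C> A' B' \<Longrightarrow> g' \<in> hom \<C> B' D' \<Longrightarrow>
       (f' \<cdot> f) \<boxtimes> (g' \<cdot> g) = (f' \<boxtimes> g') \<cdot> (f \<boxtimes> g)"
    and assoc_hom:
      "A \<in> Obj \<C> \<Longrightarrow> B \<in> Obj \<C> \<Longrightarrow> D \<in> Obj \<C> \<Longrightarrow>
       \<alpha> A B D \<in> hom \<C> ((A \<otimes> B) \<otimes> D) (A \<otimes> (B \<otimes> D))"
    and assoc_iso: "A \<in> Obj \<C> \<Longrightarrow> B \<in> Obj \<C> \<Longrightarrow> D \<in> Obj \<C> \<Longrightarrow> is_iso \<C> (\<alpha> A B D)"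
    and assoc_natural:
      "f \<in> hom \<C> A A' \<Longrightarrow> g \<in> hom \<C> B B' \<Longrightarrow> h \<in> hom \<C> D D' \<Longrightarrow>
       \<alpha> A' B' D' \<cdot> ((f \<boxtimes> g) \<boxtimes> h) = (f \<boxtimes> (g \<boxtimes> h)) \<cdot> \<alpha> A B D"
    and lunit_hom: "A \<in> Obj \<C> \<Longrightarrow> \<ell> A \<in> hom \<C> (\<^bold>I \<otimes> A) A"
    and lunit_iso: "A \<in> Obj \<C> \<Longrightarrow> is_iso \<C> (\<ell> A)"
    and lunit_natural: "f \<in> hom \<C> A B \<Longrightarrow> \<ell> B \<cdot> (\<^bold>1 \<^bold>I \<boxtimes> f) = f \<cdot> \<ell> A"
    and runit_hom: "A \<in> Obj \<C> \<Longrightarrow> \<rho> A \<in> hom \<C> (A \<otimes> \<^bold>I) A"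
    and runit_iso: "A \<in> Obj \<C> \<Longrightarrow> is_iso \<C> (\<rho> A)"
    and runit_natural: "f \<in> hom \<C> A B \<Longrightarrow> \<rho> B \<cdot> (f \<boxtimes> \<^bold>1 \<^bold>I) = f \<cdot> \<rho> A"
    and pentagon:
      "A \<in> Obj \<C> \<Longrightarrow> B \<in> Obj \<C> \<Longrightarrow> D \<in> Obj \<C> \<Longrightarrow> E \<in> Obj \<C> \<Longrightarrow>
       \<alpha> A B (D \<otimes> E) \<cdot> \<alpha> (A \<otimes> B) D E =
       (\<^bold>1 A \<boxtimes> \<alpha> B D E) \<cdot> \<alpha> A (B \<otimes> D) E \<cdot> (\<alpha> A B D \<boxtimes> \<^bold>1 E)"
    and triangle:
      "A \<in> Obj \<C> \<Longrightarrow> B \<in> Obj \<C> \<Longrightarrow> (\<^bold>1 A \<boxtimes> \<ell> B) \<cdot> \<alpha> A \<^bold>I B = \<rho> A \<boxtimes> \<^bold>1 B"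
    and swap_hom: "A \<in> Obj \<C> \<Longrightarrow> B \<in> Obj \<C> \<Longrightarrow> swap A B \<in> hom \<C> (A \<otimes> B) (B \<otimes> A)"
    and swap_natural:
      "f \<in> hom \<C> A A' \<Longrightarrow> g \<in> hom \<C> B B' \<Longrightarrow>
       swap A' B' \<cdot> (f \<boxtimes> g) = (g \<boxtimes> f) \<cdot> swap A B"
    and swap_swap: "A \<in> Obj \<C> \<Longrightarrow> B \<in> Obj \<C> \<Longrightarrow> swap B A \<cdot> swap A B = \<^bold>1 (A \<otimes> B)"
    and hexagon:
      "A \<in> Obj \<C> \<Longrightarrow> B \<in> Obj \<C> \<Longrightarrow> D \<in> Obj \<C> \<Longrightarrow>
       \<alpha> B D A \<cdot> swap A (B \<otimes> D) \<cdot> \<alpha> A B D =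
       (\<^bold>1 B \<boxtimes> swap A D) \<cdot> \<alpha> B A D \<cdot> (swap A B \<boxtimes> \<^bold>1 D)"

section \<open>Gs-monoidal categories\<close>

record ('o, 'm) gs_monoidal = "('o, 'm) monoidal" +
  copy_arr :: "'o \<Rightarrow> 'm" ("copy\<index>")
  del_arr :: "'o \<Rightarrow> 'm" ("del\<index>")

context
  fixes \<C> :: "('o, 'm, 'x) gs_monoidal_scheme" (structure)
begin

text \<open>
  \<open>\<^bold>1 A \<boxtimes> swap A X \<boxtimes> \<^bold>1 X\<close>, rebracketed to go from \<open>(A \<otimes> A) \<otimes> (X \<otimes> X)\<close> to
  \<open>(A \<otimes> X) \<otimes> (A \<otimes> X)\<close>.
\<close>

definition middle_swap :: "'o \<Rightarrow> 'o \<Rightarrow> 'm" where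
  "middle_swap A X =
     inv_arrow \<C> (\<alpha> A X (A \<otimes> X)) \<cdot>
     (\<^bold>1 A \<boxtimes> (\<alpha> X A X \<cdot> (swap A X \<boxtimes> \<^bold>1 X) \<cdot> inv_arrow \<C> (\<alpha> A X X))) \<cdot>
     \<alpha> A A (X \<otimes> X)"

definition dom :: "'m \<Rightarrow> 'm" where
  "dom f = \<rho> (src \<C> f) \<cdot> (\<^bold>1 (src \<C> f) \<boxtimes> (del (tgt \<C> f) \<cdot> f)) \<cdot> copy (src \<C> f)"

definition normalized :: "'m \<Rightarrow> bool" where
  "normalized f \<longleftrightarrow> f \<cdot> dom f = f"

definition functional :: "'m \<Rightarrow> bool" where
  "functional f \<longleftrightarrow> copy (tgt \<C> f) \<cdot> f = (f \<boxtimes> f) \<cdot> copy (src \<C> f)"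

definition hom_fun :: "'o \<Rightarrow> 'o \<Rightarrow> 'm set" where
  "hom_fun A X = {f \<in> hom \<C> A X. functional f}"

definition extends :: "'m \<Rightarrow> 'm \<Rightarrow> bool" where
  "extends f g \<longleftrightarrow> f \<cdot> dom g = g"

definition Im_fun :: "'m \<Rightarrow> 'm set" where
  "Im_fun f = {f \<cdot> a | a. a \<in> hom_fun \<^bold>I (src \<C> f)}"

end

locale gs_monoidal_category = symmetric_monoidal_category \<C>
  for \<C> :: "('o, 'm, 'x) gs_monoidal_scheme" (structure) +
  assumes copy_hom: "A \<in> Obj \<C> \<Longrightarrow> copy A \<in> hom \<C> A (A \<otimes> A)"
    and del_hom: "A \<in> Obj \<C> \<Longrightarrow> del A \<in> hom \<C> A \<^bold>I"
    and copy_coassoc: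
      "A \<in> Obj \<C> \<Longrightarrow> \<alpha> A A A \<cdot> (copy A \<boxtimes> \<^bold>1 A) \<cdot> copy A = (\<^bold>1 A \<boxtimes> copy A) \<cdot> copy A"
    and copy_counit_left: "A \<in> Obj \<C> \<Longrightarrow> \<ell> A \<cdot> (del A \<boxtimes> \<^bold>1 A) \<cdot> copy A = \<^bold>1 A"
    and copy_counit_right: "A \<in> Obj \<C> \<Longrightarrow> \<rho> A \<cdot> (\<^bold>1 A \<boxtimes> del A) \<cdot> copy A = \<^bold>1 A"
    and copy_comm: "A \<in> Obj \<C> \<Longrightarrow> swap A A \<cdot> copy A = copy A"
    and copy_tensor:
      "A \<in> Obj \<C> \<Longrightarrow> X \<in> Obj \<C> \<Longrightarrow> copy (A \<otimes> X) = middle_swap \<C> A X \<cdot> (copy A \<boxtimes> copy X)"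
    and del_tensor:
      "A \<in> Obj \<C> \<Longrightarrow> X \<in> Obj \<C> \<Longrightarrow> del (A \<otimes> X) = \<ell> \<^bold>I \<cdot> (del A \<boxtimes> del X)"
    and del_unit: "del \<^bold>I = \<^bold>1 \<^bold>I"

section \<open>Target--context categories and simulators\<close>

record ('o, 'm) target_context = "('o, 'm) gs_monoidal" +
  Target :: 'o ("\<^bold>T\<index>")
  Context :: 'o ("\<^bold>C\<index>")
  rel :: "'m \<Rightarrow> 'm \<Rightarrow> bool" (infix "\<succeq>\<index>" 50)

locale target_context_category = gs_monoidal_category \<C>
  for \<C> :: "('o, 'm, 'x) target_context_scheme" (structure) +
  assumes all_normalized: "f \<in> Arr \<C> \<Longrightarrow> normalized \<C> f"
    and target_obj: "\<^bold>T \<in> Obj \<C>"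
    and context_obj: "\<^bold>C \<in> Obj \<C>"
    and rel_refl: "A \<in> Obj \<C> \<Longrightarrow> reflp_on (hom \<C> A (\<^bold>T \<otimes> \<^bold>C)) (\<succeq>)"
    and rel_trans: "A \<in> Obj \<C> \<Longrightarrow> transp_on (hom \<C> A (\<^bold>T \<otimes> \<^bold>C)) (\<succeq>)"
    and rel_extends:
      "f \<in> hom \<C> A (\<^bold>T \<otimes> \<^bold>C) \<Longrightarrow> g \<in> hom \<C> A (\<^bold>T \<otimes> \<^bold>C) \<Longrightarrow> extends \<C> f g \<Longrightarrow> f \<succeq> g"
    and rel_precomp:
      "f \<in> hom \<C> A (\<^bold>T \<otimes> \<^bold>C) \<Longrightarrow> g \<in> hom \<C> A (\<^bold>T \<otimes> \<^bold>C) \<Longrightarrow> h \<in> hom \<C> Z A \<Longrightarrow> f \<succeq> g \<Longrightarrow>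
       f \<cdot> h \<succeq> g \<cdot> h"

context
  fixes \<C> :: "('o, 'm, 'x) target_context_scheme" (structure)
begin

definition simulator_via :: "'o \<Rightarrow> 'm \<Rightarrow> 'm \<Rightarrow> 'm \<Rightarrow> bool" where
  "simulator_via P s s\<^sub>T s\<^sub>C \<longleftrightarrow>
     P \<in> Obj \<C> \<and> s \<in> hom \<C> (P \<otimes> \<^bold>C) (\<^bold>T \<otimes> \<^bold>C) \<and>
     s\<^sub>T \<in> hom_fun \<C> P \<^bold>T \<and> s\<^sub>C \<in> hom \<C> (P \<otimes> \<^bold>C) \<^bold>C \<and>
     s = (s\<^sub>T \<boxtimes> s\<^sub>C) \<cdot> \<alpha> P P \<^bold>C \<cdot> (copy P \<boxtimes> \<^bold>1 \<^bold>C) \<and>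
     (\<^bold>1 \<^bold>T \<boxtimes> del \<^bold>C) \<cdot> s = s\<^sub>T \<boxtimes> del \<^bold>C \<and>
     \<ell> \<^bold>C \<cdot> (del \<^bold>T \<boxtimes> \<^bold>1 \<^bold>C) \<cdot> s = s\<^sub>C"

definition simulator :: "'o \<Rightarrow> 'm \<Rightarrow> bool" where
  "simulator P s \<longleftrightarrow> (\<exists>s\<^sub>T s\<^sub>C. simulator_via P s s\<^sub>T s\<^sub>C)"

definition is_compiler :: "'o \<Rightarrow> 'm \<Rightarrow> 'm \<Rightarrow> bool" where
  "is_compiler P s s\<^sub>T \<longleftrightarrow> (\<exists>s\<^sub>C. simulator_via P s s\<^sub>T s\<^sub>C)"

definition universal_simulator :: "'o \<Rightarrow> 'm \<Rightarrow> bool" where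
  "universal_simulator P s \<longleftrightarrow>
     simulator P s \<and> (\<exists>r \<in> hom_fun \<C> \<^bold>T P. s \<cdot> (r \<boxtimes> \<^bold>1 \<^bold>C) \<succeq> \<^bold>1 (\<^bold>T \<otimes> \<^bold>C))"

definition lax_context_reduces :: "'o \<Rightarrow> 'm \<Rightarrow> 'm \<Rightarrow> bool" where
  "lax_context_reduces A f g \<longleftrightarrow>
     f \<in> hom \<C> A \<^bold>T \<and> g \<in> hom \<C> A \<^bold>T \<and>
     (\<exists>f\<^sub>C \<in> hom \<C> (A \<otimes> \<^bold>C) \<^bold>C. (f \<boxtimes> f\<^sub>C) \<cdot> \<alpha> A A \<^bold>C \<cdot> (copy A \<boxtimes> \<^bold>1 \<^bold>C) \<succeq> g \<boxtimes> \<^bold>1 \<^bold>C)"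

end

end

theory Submission
  imports Defs
begin

text \<open>
  Precomposing \<open>s \<cdot> (r \<boxtimes> \<^bold>1 \<^bold>C) \<succeq> \<^bold>1 (\<^bold>T \<otimes> \<^bold>C)\<close> with \<open>t \<boxtimes> \<^bold>1 \<^bold>C\<close> shows, because \<open>r \<cdot> t\<close> can be copied,
  that \<open>s\<^sub>T \<cdot> (r \<cdot> t)\<close> lax context-reduces to \<open>t\<close>, for every functional \<open>t\<close>. Hence a universal
  simulator has in the image of its compiler an element of \<open>\<phi>\<close>-value at least \<open>\<phi> t\<close>.
\<close>

context gs_monoidal_category
begin

text \<open>Copying after \<open>g \<cdot> f\<close> slides back first past \<open>g\<close>, then
  past \<open>f\<close>, and interchange merges the two resulting pairs. This keeps both the program
  \<open>r \<cdot> t\<close> and its compilation functional.\<close>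

lemma functional_comp:
  assumes f: "f \<in> hom_fun \<C> A B" and g: "g \<in> hom_fun \<C> B D"
  shows "g \<cdot> f \<in> hom_fun \<C> A D"
proof -
  have fh: "f \<in> hom \<C> A B" and gh: "g \<in> hom \<C> B D"
    and fc: "copy B \<cdot> f = (f \<boxtimes> f) \<cdot> copy A" and gc: "copy D \<cdot> g = (g \<boxtimes> g) \<cdot> copy B"
    using f g by (auto simp: hom_fun_def functional_def hom_def)
  have ob: "A \<in> Obj \<C>" "B \<in> Obj \<C>" "D \<in> Obj \<C>"
    using fh gh src_obj tgt_obj by (auto simp: hom_def)
  have gfh: "g \<cdot> f \<in> hom \<C> A D" using fh gh by (rule comp_hom)
  have "copy D \<cdot> (g \<cdot> f) = (copy D \<cdot> g) \<cdot> f"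
    using comp_assoc[OF fh gh copy_hom[OF ob(3)]] by simp
  also have "\<dots> = (g \<boxtimes> g) \<cdot> (copy B \<cdot> f)"
    unfolding gc by (rule comp_assoc[OF fh copy_hom[OF ob(2)] tensor_hom[OF gh gh]])
  also have "\<dots> = ((g \<boxtimes> g) \<cdot> (f \<boxtimes> f)) \<cdot> copy A"
    unfolding fc
    by (rule comp_assoc[OF copy_hom[OF ob(1)] tensor_hom[OF fh fh] tensor_hom[OF gh gh], symmetric])
  also have "\<dots> = ((g \<cdot> f) \<boxtimes> (g \<cdot> f)) \<cdot> copy A"
    by (simp only: interchange[OF fh gh fh gh])
  finally show ?thesis
    using gfh by (auto simp: hom_fun_def functional_def hom_def)
qed

text \<open>A functional \<open>a\<close> passes through the copy as two copies of itself, one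
  absorbed by \<open>u\<close> and the other by \<open>v\<close>. With \<open>u\<close>,
  \<open>v\<close> the compiler and context reduction of a simulator, the right-hand side has the
  shape required in \<open>lax_context_reduces\<close>.\<close>

lemma copy_whisker_precomp_functional:
  assumes a: "a \<in> hom_fun \<C> A P" and c: "c \<in> Obj \<C>"
    and u: "u \<in> hom \<C> P X" and v: "v \<in> hom \<C> (P \<otimes> c) Y"
  shows "((u \<boxtimes> v) \<cdot> \<alpha> P P c \<cdot> (copy P \<boxtimes> \<^bold>1 c)) \<cdot> (a \<boxtimes> \<^bold>1 c) =
    ((u \<cdot> a) \<boxtimes> (v \<cdot> (a \<boxtimes> \<^bold>1 c))) \<cdot> \<alpha> A A c \<cdot> (copy A \<boxtimes> \<^bold>1 c)"
proof -
  have ah: "a \<in> hom \<C> A P" and ac: "copy P \<cdot> a = (a \<boxtimes> a) \<cdot> copy A"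
    using a by (auto simp: hom_fun_def functional_def hom_def)
  have ob: "A \<in> Obj \<C>" "P \<in> Obj \<C>"
    using ah src_obj tgt_obj by (auto simp: hom_def)
  note i = id_hom[OF c]
  note cA = tensor_hom[OF copy_hom[OF ob(1)] i] and cP = tensor_hom[OF copy_hom[OF ob(2)] i]
  note a1 = tensor_hom[OF ah i] and aa = tensor_hom[OF ah ah]
  note aa1 = tensor_hom[OF aa i] and a_a1 = tensor_hom[OF ah a1]
  note alA = assoc_hom[OF ob(1) ob(1) c] and alP = assoc_hom[OF ob(2) ob(2) c]
  note uv = tensor_hom[OF u v]
  \<comment> \<open>By interchange both sides are \<open>copy P \<cdot> a\<close>, respectively its
    rewriting by functionality of \<open>a\<close>, tensored with the identity of
    \<open>c\<close>.\<close>
  have copied: "(copy P \<boxtimes> \<^bold>1 c) \<cdot> (a \<boxtimes> \<^bold>1 c) = ((a \<boxtimes> a) \<boxtimes> \<^bold>1 c) \<cdot> (copy A \<boxtimes> \<^bold>1 c)"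
    using interchange[OF ah copy_hom[OF ob(2)] i i] interchange[OF copy_hom[OF ob(1)] aa i i] ac
    by simp
  have "((u \<boxtimes> v) \<cdot> \<alpha> P P c \<cdot> (copy P \<boxtimes> \<^bold>1 c)) \<cdot> (a \<boxtimes> \<^bold>1 c)
      = (u \<boxtimes> v) \<cdot> \<alpha> P P c \<cdot> ((copy P \<boxtimes> \<^bold>1 c) \<cdot> (a \<boxtimes> \<^bold>1 c))"
    by (simp only: comp_assoc[OF a1 comp_hom[OF cP alP] uv] comp_assoc[OF a1 cP alP])
  also have "\<dots> = (u \<boxtimes> v) \<cdot> (\<alpha> P P c \<cdot> ((a \<boxtimes> a) \<boxtimes> \<^bold>1 c)) \<cdot> (copy A \<boxtimes> \<^bold>1 c)"
    by (simp only: copied comp_assoc[OF cA aa1 alP])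
  \<comment> \<open>Naturality of the associator leaves the first \<open>a\<close> alone and groups
    the second with \<open>c\<close>, matching the inputs of \<open>u\<close> and
    \<open>v\<close>.\<close>
  also have "\<dots> = (u \<boxtimes> v) \<cdot> ((a \<boxtimes> (a \<boxtimes> \<^bold>1 c)) \<cdot> \<alpha> A A c) \<cdot> (copy A \<boxtimes> \<^bold>1 c)"
    by (simp only: assoc_natural[OF ah ah i])
  also have "\<dots> = ((u \<boxtimes> v) \<cdot> (a \<boxtimes> (a \<boxtimes> \<^bold>1 c))) \<cdot> \<alpha> A A c \<cdot> (copy A \<boxtimes> \<^bold>1 c)"
    by (simp only: comp_assoc[OF cA alA a_a1] comp_assoc[OF comp_hom[OF cA alA] a_a1 uv])
  also have "\<dots> = ((u \<cdot> a) \<boxtimes> (v \<cdot> (a \<boxtimes> \<^bold>1 c))) \<cdot> \<alpha> A A c \<cdot> (copy A \<boxtimes> \<^bold>1 c)"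
    by (simp only: interchange[OF ah u a1 v])
  finally show ?thesis .
qed

end

lemma (in target_context_category) compiled_lax_context_reduces:
  assumes sim: "simulator_via \<C> P s s\<^sub>T s\<^sub>C"
    and r: "r \<in> hom_fun \<C> \<^bold>T P" and univ: "s \<cdot> (r \<boxtimes> \<^bold>1 \<^bold>C) \<succeq> \<^bold>1 (\<^bold>T \<otimes> \<^bold>C)"
    and t: "t \<in> hom_fun \<C> A \<^bold>T"
  shows "lax_context_reduces \<C> A (s\<^sub>T \<cdot> (r \<cdot> t)) t"
proof -
  have sh: "s \<in> hom \<C> (P \<otimes> \<^bold>C) (\<^bold>T \<otimes> \<^bold>C)" and sT: "s\<^sub>T \<in> hom \<C> P \<^bold>T"
    and sC: "s\<^sub>C \<in> hom \<C> (P \<otimes> \<^bold>C) \<^bold>C"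
    and s: "s = (s\<^sub>T \<boxtimes> s\<^sub>C) \<cdot> \<alpha> P P \<^bold>C \<cdot> (copy P \<boxtimes> \<^bold>1 \<^bold>C)"
    using sim by (auto simp: simulator_via_def hom_fun_def)
  have rh: "r \<in> hom \<C> \<^bold>T P" and th: "t \<in> hom \<C> A \<^bold>T"
    using r t by (auto simp: hom_fun_def)
  note i = id_hom[OF context_obj]
  note r1 = tensor_hom[OF rh i] and t1 = tensor_hom[OF th i]
  note rt = functional_comp[OF t r] and rth = comp_hom[OF th rh]
  \<comment> \<open>The witness is the context reduction of \<open>s\<close> run on the program
    \<open>r \<cdot> t\<close>.\<close>
  let ?f\<^sub>C = "s\<^sub>C \<cdot> ((r \<cdot> t) \<boxtimes> \<^bold>1 \<^bold>C)"
  have TC: "\<^bold>T \<otimes> \<^bold>C \<in> Obj \<C>" using target_obj context_obj by (rule tensor_obj)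
  have "(s \<cdot> (r \<boxtimes> \<^bold>1 \<^bold>C)) \<cdot> (t \<boxtimes> \<^bold>1 \<^bold>C) = s \<cdot> ((r \<cdot> t) \<boxtimes> \<^bold>1 \<^bold>C)"
    using comp_assoc[OF t1 r1 sh] interchange[OF th rh i i] comp_id_left[OF i] by simp
  also have "\<dots> = ((s\<^sub>T \<cdot> (r \<cdot> t)) \<boxtimes> ?f\<^sub>C) \<cdot> \<alpha> A A \<^bold>C \<cdot> (copy A \<boxtimes> \<^bold>1 \<^bold>C)"
    unfolding s by (rule copy_whisker_precomp_functional[OF rt context_obj sT sC])
  \<comment> \<open>Precomposing the universality relation turns its right side, an identity, into
    \<open>t\<close> tensored with the identity of the context object.\<close>
  finally have "((s\<^sub>T \<cdot> (r \<cdot> t)) \<boxtimes> ?f\<^sub>C) \<cdot> \<alpha> A A \<^bold>C \<cdot> (copy A \<boxtimes> \<^bold>1 \<^bold>C) \<succeq> t \<boxtimes> \<^bold>1 \<^bold>C"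
    using rel_precomp[OF comp_hom[OF r1 sh] id_hom[OF TC] t1 univ] comp_id_left[OF t1] by simp
  moreover have "?f\<^sub>C \<in> hom \<C> (A \<otimes> \<^bold>C) \<^bold>C"
    using tensor_hom[OF rth i] sC by (rule comp_hom)
  ultimately show ?thesis
    using comp_hom[OF rth sT] th by (auto simp: lax_context_reduces_def)
qed

theorem mainTheorem1:
  fixes \<C> :: "('o, 'm, 'x) target_context_scheme" (structure)
    and P :: 'o and s s\<^sub>T :: 'm and \<phi> :: "'m \<Rightarrow> real"
  assumes "target_context_category \<C>"
    and "simulator \<C> P s"
    and "is_compiler \<C> P s s\<^sub>T"
    and "\<And>f g. f \<in> hom_fun \<C> \<^bold>I \<^bold>T \<Longrightarrow> g \<in> hom_fun \<C> \<^bold>I \<^bold>T \<Longrightarrow>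
           lax_context_reduces \<C> \<^bold>I f g \<Longrightarrow> \<phi> f \<ge> \<phi> g"
    and "(SUP f \<in> Im_fun \<C> s\<^sub>T. ereal (\<phi> f)) < (SUP f \<in> Im_fun \<C> (\<^bold>1 \<^bold>T). ereal (\<phi> f))"
  shows "\<not> universal_simulator \<C> P s"
proof
  interpret target_context_category \<C> by fact
  assume "universal_simulator \<C> P s"
  then obtain r where r: "r \<in> hom_fun \<C> \<^bold>T P" and univ: "s \<cdot> (r \<boxtimes> \<^bold>1 \<^bold>C) \<succeq> \<^bold>1 (\<^bold>T \<otimes> \<^bold>C)"
    by (auto simp: universal_simulator_def)
  \<comment> \<open>Universality only asserts that some decomposition of \<open>s\<close> exists;
    the one chosen here has the compiler \<open>s\<^sub>T\<close> to which the supremum hypothesis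
    refers.\<close>
  obtain s\<^sub>C where sim: "simulator_via \<C> P s s\<^sub>T s\<^sub>C"
    using assms(3) by (auto simp: is_compiler_def)
  then have sT: "s\<^sub>T \<in> hom_fun \<C> P \<^bold>T" by (simp add: simulator_via_def)
  then have src_sT: "src \<C> s\<^sub>T = P" by (simp add: hom_fun_def hom_def)
  have src_id: "src \<C> (\<^bold>1 \<^bold>T) = \<^bold>T" using id_hom[OF target_obj] by (simp add: hom_def)
  \<comment> \<open>Suprema are taken in \<open>ereal\<close>, so a termwise bound suffices even if
    a set of values is empty or unbounded.\<close>
  have "(SUP f \<in> Im_fun \<C> (\<^bold>1 \<^bold>T). ereal (\<phi> f)) \<le> (SUP f \<in> Im_fun \<C> s\<^sub>T. ereal (\<phi> f))"
  proof (rule SUP_least)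
    fix f assume "f \<in> Im_fun \<C> (\<^bold>1 \<^bold>T)"
    then obtain t where t: "t \<in> hom_fun \<C> \<^bold>I \<^bold>T" and "f = \<^bold>1 \<^bold>T \<cdot> t"
      by (auto simp: Im_fun_def src_id)
    then have f: "f = t" using comp_id_left by (auto simp: hom_fun_def)
    have rt: "r \<cdot> t \<in> hom_fun \<C> \<^bold>I P" using t r by (rule functional_comp)
    have "\<phi> (s\<^sub>T \<cdot> (r \<cdot> t)) \<ge> \<phi> t"
      using functional_comp[OF rt sT] t compiled_lax_context_reduces[OF sim r univ t]
      by (rule assms(4))
    moreover have "s\<^sub>T \<cdot> (r \<cdot> t) \<in> Im_fun \<C> s\<^sub>T"
      using rt by (auto simp: Im_fun_def src_sT)
    ultimately show "ereal (\<phi> f) \<le> (SUP f \<in> Im_fun \<C> s\<^sub>T. ereal (\<phi> f))"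
      unfolding f by (intro SUP_upper2) auto
  qed
  with assms(5) show False by simp
qed

end
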